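(* Let $k$ be a non-negative integer, $n=2k+1$, and let $L=HFL_n$ be a Heisenberg-Fock Leibniz algebra, i.e. a Leibniz algebra over $\mathbb{F}$ whose corresponding Lie algebra $L/I$ is the Heisenberg algebra $H_n$ and such that the action $I\times H_n\to I$ makes $I$ (isomorphic to) the Fock module $\mathbb{F}[x_1,\dots,x_k]$. Then $L$ admits a basis $$\{\overline{1},\ \overline{x}_i,\ \tfrac{\overline{\delta}}{\delta x_i},\ x_1^{t_1}x_2^{t_2}\cdots x_k^{t_k}\ \mid\ t_i\in\mathbb{N}\cup\{0\},\ 1\le i\le k\}$$ in which the multiplication table is $$[\overline{x}_i,\tfrac{\overline{\delta}}{\delta x_i}]=\overline{1},\qquad [\tfrac{\overline{\delta}}{\delta x_i},\overline{x}_i]=-\overline{1},\qquad 1\le i\le k,$$ $$[x_1^{t_1}\cdots x_k^{t_k},\overline{1}]=x_1^{t_1}\cdots x_k^{t_k},$$ $$[x_1^{t_1}\cdots x_k^{t_k},\overline{x}_i]=x_1^{t_1}\cdots x_{i-1}^{t_{i-1}}x_i^{t_i+1}x_{i+1}^{t_{i+1}}\cdots x_k^{t_k},\qquad 1\le i\le k,$$ $$[x_1^{t_1}\cdots x_k^{t_k},\tfrac{\overline{\delta}}{\delta x_i}]=t_i\,x_1^{t_1}\cdots x_{i-1}^{t_{i-1}}x_i^{t_i-1}x_{i+1}^{t_{i+1}}\cdots x_k^{t_k},\qquad 1\le i\le k,$$ where all omitted products of basis elements are zero.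
   Context: $\mathbb{F}$ is an algebraically closed field of characteristic zero. A Leibniz algebra is an $\mathbb{F}$-vector space $L$ with a bilinear product $[\cdot,\cdot]$ satisfying $[[y,z],x]=[[y,x],z]+[y,[z,x]]$ for all $x,y,z\in L$. $I$ denotes the ideal of $L$ generated by $\{[x,x]:x\in L\}$; it satisfies $[L,I]=0$, the quotient $L/I$ is a Lie algebra (the corresponding Lie algebra of $L$), and $I$ is a (right) $L/I$-module via $(i,[x])\mapsto [i,x]$. A (right) module $M$ over a Lie algebra $\mathfrak g$ satisfies $m\cdot[a,b]=(m\cdot a)\cdot b-(m\cdot b)\cdot a$. The Heisenberg algebra $H_n$, $n=2k+1$, is the Lie algebra with basis $\{\overline{1},\overline{x}_1,\frac{\overline{\delta}}{\delta x_1},\dots,\overline{x}_k,\frac{\overline{\delta}}{\delta x_k}\}$ and nonzero products $[\overline{x}_i,\frac{\overline{\delta}}{\delta x_i}]=-[\frac{\overline{\delta}}{\delta x_i},\overline{x}_i]=\overline{1}$, $1\le i\le k$. The Fock module on $H_n$ is the vector space $\mathbb{F}[x_1,\dots,x_k]$ with action $(p,\overline{1})\mapsto p$, $(p,\overline{x}_i)\mapsto x_ip$, $(p,\frac{\overline{\delta}}{\delta x_i})\mapsto \frac{\delta}{\delta x_i}(p)$ (partial derivative). In the multiplication table, terms with coefficient $t_i=0$ are zero. *)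

theory Defs
  imports
    Main
    "HOL.Hull"
    "HOL-Library.Poly_Mapping"
    "HOL-Computational_Algebra.Polynomial"
begin

section \<open>The Heisenberg algebra\<close>

text \<open>
  Vectors over a basis \<open>'b\<close> are finitely supported functions \<open>'b \<Rightarrow>\<^sub>0 'f\<close>.
\<close>

definition fs_scale :: "'f::semiring_0 \<Rightarrow> ('b \<Rightarrow>\<^sub>0 'f) \<Rightarrow> ('b \<Rightarrow>\<^sub>0 'f)" where
  "fs_scale c p = Poly_Mapping.map ((*) c) p"

text \<open>
  \<open>H1\<close>, \<open>Hx i\<close>, \<open>Hd i\<close> stand for the basis elements
  \<open>1\<close>, \<open>x\<^sub>i\<close>, \<open>\<delta>/\<delta>x\<^sub>i\<close> (with bars).
\<close>

datatype heis_gen = H1 | Hx nat | Hd nat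

definition heis_gens :: "nat \<Rightarrow> heis_gen set" where
  "heis_gens k = {H1} \<union> Hx ` {1..k} \<union> Hd ` {1..k}"

text \<open>The underlying space of the Heisenberg algebra of dimension \<open>2 * k + 1\<close>.\<close>

definition heis :: "nat \<Rightarrow> (heis_gen \<Rightarrow>\<^sub>0 'f::zero) set" where
  "heis k = {h. Poly_Mapping.keys h \<subseteq> heis_gens k}"

fun heis_gen_bracket :: "heis_gen \<Rightarrow> heis_gen \<Rightarrow> (heis_gen \<Rightarrow>\<^sub>0 'f::ring_1)" where
  "heis_gen_bracket (Hx i) (Hd j) = (if i = j then Poly_Mapping.single H1 1 else 0)"
| "heis_gen_bracket (Hd i) (Hx j) = (if i = j then - Poly_Mapping.single H1 1 else 0)"
| "heis_gen_bracket _ _ = 0"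

text \<open>Bilinear extension of the products of basis elements.\<close>

definition heis_bracket ::
  "(heis_gen \<Rightarrow>\<^sub>0 'f::comm_ring_1) \<Rightarrow> (heis_gen \<Rightarrow>\<^sub>0 'f) \<Rightarrow> (heis_gen \<Rightarrow>\<^sub>0 'f)" where
  "heis_bracket u v =
     (\<Sum>a\<in>Poly_Mapping.keys u. \<Sum>b\<in>Poly_Mapping.keys v.
        fs_scale (Poly_Mapping.lookup u a * Poly_Mapping.lookup v b) (heis_gen_bracket a b))"


section \<open>The Fock module\<close>

text \<open>
  An exponent vector \<open>t :: nat \<Rightarrow>\<^sub>0 nat\<close> stands for the monomial
  \<open>x\<^sub>1^t\<^sub>1 \<cdots> x\<^sub>k^t\<^sub>k\<close>; a polynomial is a finitely supported function from exponent
  vectors to coefficients, with the convolution product of the library.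
\<close>

definition exps :: "nat \<Rightarrow> (nat \<Rightarrow>\<^sub>0 nat) set" where
  "exps k = {t. Poly_Mapping.keys t \<subseteq> {1..k}}"

definition fock :: "nat \<Rightarrow> ((nat \<Rightarrow>\<^sub>0 nat) \<Rightarrow>\<^sub>0 'f::zero) set" where
  "fock k = {p. Poly_Mapping.keys p \<subseteq> exps k}"

definition poly_var :: "nat \<Rightarrow> ((nat \<Rightarrow>\<^sub>0 nat) \<Rightarrow>\<^sub>0 'f::zero_neq_one)" where
  "poly_var i = Poly_Mapping.single (Poly_Mapping.single i 1) 1"

text \<open>
  The exponent subtraction is truncated, but the coefficient is zero whenever
  truncation occurs.
\<close>

definition partial_deriv ::
  "nat \<Rightarrow> ((nat \<Rightarrow>\<^sub>0 nat) \<Rightarrow>\<^sub>0 'f::comm_ring_1) \<Rightarrow> ((nat \<Rightarrow>\<^sub>0 nat) \<Rightarrow>\<^sub>0 'f)" where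
  "partial_deriv i p =
     (\<Sum>t\<in>Poly_Mapping.keys p.
        Poly_Mapping.single (t - Poly_Mapping.single i 1)
          (of_nat (Poly_Mapping.lookup t i) * Poly_Mapping.lookup p t))"

fun fock_gen_action ::
  "((nat \<Rightarrow>\<^sub>0 nat) \<Rightarrow>\<^sub>0 'f::comm_ring_1) \<Rightarrow> heis_gen \<Rightarrow> ((nat \<Rightarrow>\<^sub>0 nat) \<Rightarrow>\<^sub>0 'f)" where
  "fock_gen_action p H1 = p"
| "fock_gen_action p (Hx i) = poly_var i * p"
| "fock_gen_action p (Hd i) = partial_deriv i p"

text \<open>Linear extension in the second argument.\<close>

definition fock_action ::
  "((nat \<Rightarrow>\<^sub>0 nat) \<Rightarrow>\<^sub>0 'f::comm_ring_1) \<Rightarrow> (heis_gen \<Rightarrow>\<^sub>0 'f) \<Rightarrow> ((nat \<Rightarrow>\<^sub>0 nat) \<Rightarrow>\<^sub>0 'f)" where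
  "fock_action p h =
     (\<Sum>a\<in>Poly_Mapping.keys h. fs_scale (Poly_Mapping.lookup h a) (fock_gen_action p a))"


section \<open>Leibniz algebras\<close>

locale leibniz_algebra = vector_space scale
  for scale :: "'f::field \<Rightarrow> 'l::ab_group_add \<Rightarrow> 'l" +
  fixes bracket :: "'l \<Rightarrow> 'l \<Rightarrow> 'l"
  assumes linear_left: "Vector_Spaces.linear scale scale (\<lambda>x. bracket x y)"
    and linear_right: "Vector_Spaces.linear scale scale (\<lambda>y. bracket x y)"
    and leibniz: "bracket (bracket y z) x = bracket (bracket y x) z + bracket y (bracket z x)"
begin

definition is_ideal :: "'l set \<Rightarrow> bool" where
  "is_ideal J \<longleftrightarrow> subspace J \<and> (\<forall>j\<in>J. \<forall>x. bracket j x \<in> J \<and> bracket x j \<in> J)"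

text \<open>The ideal \<open>I\<close> generated by all squares.\<close>

definition leib_ker :: "'l set" where
  "leib_ker = is_ideal hull (range (\<lambda>x. bracket x x))"

subsection \<open>The corresponding Lie algebra\<close>

text \<open>
  Elements of the quotient are cosets.  As for the multiplication of cosets of ideals in
  HOL-Algebra, an operation on cosets is the union of the cosets of the results on all
  representatives; see the lemmas below for its value on \<open>coset x\<close>, \<open>coset y\<close>.
\<close>

definition coset :: "'l \<Rightarrow> 'l set" where
  "coset x = (\<lambda>i. x + i) ` leib_ker"

definition lie_quot :: "'l set set" where
  "lie_quot = range coset"

definition quot_add :: "'l set \<Rightarrow> 'l set \<Rightarrow> 'l set" where
  "quot_add A B = (\<Union>a\<in>A. \<Union>b\<in>B. coset (a + b))"

definition quot_scale :: "'f \<Rightarrow> 'l set \<Rightarrow> 'l set" where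
  "quot_scale c A = (\<Union>a\<in>A. coset (scale c a))"

definition quot_bracket :: "'l set \<Rightarrow> 'l set \<Rightarrow> 'l set" where
  "quot_bracket A B = (\<Union>a\<in>A. \<Union>b\<in>B. coset (bracket a b))"

lemma is_ideal_leib_ker: "is_ideal leib_ker"
proof -
  have "is_ideal (\<Inter>T)" if "\<And>t. t \<in> T \<Longrightarrow> is_ideal t" for T
  proof -
    have "subspace (\<Inter>T)"
      using that by (intro subspace_Inter) (auto simp: is_ideal_def)
    then show ?thesis
      using that by (auto simp: is_ideal_def)
  qed
  then show ?thesis
    unfolding leib_ker_def by (rule hull_in[of is_ideal]) blast
qed

lemma coset_eq_iff: "coset x = coset y \<longleftrightarrow> x - y \<in> leib_ker"
proof -
  have sub: "subspace leib_ker"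
    using is_ideal_leib_ker by (simp add: is_ideal_def)
  have mem: "z \<in> coset w \<longleftrightarrow> z - w \<in> leib_ker" for z w
  proof
    assume "z - w \<in> leib_ker"
    then show "z \<in> coset w"
      unfolding coset_def by (intro image_eqI[of _ _ "z - w"]) auto
  qed (auto simp: coset_def)
  show ?thesis
  proof
    assume "coset x = coset y"
    moreover have "x \<in> coset x"
      using subspace_0[OF sub] by (simp add: mem)
    ultimately show "x - y \<in> leib_ker"
      by (simp add: mem)
  next
    assume xy: "x - y \<in> leib_ker"
    have "z - x \<in> leib_ker \<longleftrightarrow> z - y \<in> leib_ker" for z
    proof
      assume "z - x \<in> leib_ker"
      from subspace_add[OF sub this xy] show "z - y \<in> leib_ker"
        by simp
    next
      assume "z - y \<in> leib_ker"
      from subspace_diff[OF sub this xy] show "z - x \<in> leib_ker"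
        by simp
    qed
    then show "coset x = coset y"
      by (simp add: set_eq_iff mem)
  qed
qed

lemma mem_coset_iff: "z \<in> coset w \<longleftrightarrow> coset z = coset w"
proof -
  have "z \<in> coset w" if "z - w \<in> leib_ker"
    using that unfolding coset_def by (intro image_eqI[of _ _ "z - w"]) simp_all
  moreover have "z - w \<in> leib_ker" if "z \<in> coset w"
    using that by (auto simp: coset_def)
  ultimately show ?thesis
    by (auto simp only: coset_eq_iff)
qed

lemma quot_add_coset: "quot_add (coset x) (coset y) = coset (x + y)"
proof -
  have sub: "subspace leib_ker"
    using is_ideal_leib_ker by (simp add: is_ideal_def)
  have "coset (a + b) = coset (x + y)" if "a \<in> coset x" "b \<in> coset y" for a b
  proof -
    have "(a - x) + (b - y) \<in> leib_ker"
      using that by (intro subspace_add[OF sub]) (simp_all only: mem_coset_iff coset_eq_iff)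
    moreover have "(a - x) + (b - y) = (a + b) - (x + y)"
      by simp
    ultimately show ?thesis
      by (simp only: coset_eq_iff)
  qed
  moreover have "x \<in> coset x" "y \<in> coset y"
    by (simp_all add: mem_coset_iff)
  ultimately show ?thesis
    unfolding quot_add_def by blast
qed

lemma quot_scale_coset: "quot_scale c (coset x) = coset (scale c x)"
proof -
  have sub: "subspace leib_ker"
    using is_ideal_leib_ker by (simp add: is_ideal_def)
  have "coset (scale c a) = coset (scale c x)" if "a \<in> coset x" for a
  proof -
    have "scale c (a - x) \<in> leib_ker"
      using that by (intro subspace_scale[OF sub]) (simp only: mem_coset_iff coset_eq_iff)
    then show ?thesis
      by (simp only: coset_eq_iff scale_right_diff_distrib)
  qed
  moreover have "x \<in> coset x"
    by (simp add: mem_coset_iff)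
  ultimately show ?thesis
    unfolding quot_scale_def by blast
qed

lemma quot_bracket_coset: "quot_bracket (coset x) (coset y) = coset (bracket x y)"
proof -
  have sub: "subspace leib_ker"
    and idl: "\<And>j z. j \<in> leib_ker \<Longrightarrow> bracket j z \<in> leib_ker \<and> bracket z j \<in> leib_ker"
    using is_ideal_leib_ker by (auto simp: is_ideal_def)
  have diff_left: "bracket (u - v) z = bracket u z - bracket v z" for u v z
    using linear_left[of z] module_hom.diff[of scale scale "\<lambda>x. bracket x z" u v]
    by (simp add: Vector_Spaces.linear_def)
  have diff_right: "bracket z (u - v) = bracket z u - bracket z v" for u v z
    using linear_right[of z] module_hom.diff[of scale scale "bracket z" u v]
    by (simp add: Vector_Spaces.linear_def)
  have "coset (bracket a b) = coset (bracket x y)" if "a \<in> coset x" "b \<in> coset y" for a b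
  proof -
    have "bracket (a - x) b \<in> leib_ker" "bracket x (b - y) \<in> leib_ker"
      using that idl by (simp_all only: mem_coset_iff coset_eq_iff)
    then show ?thesis
      using subspace_add[OF sub, of "bracket (a - x) b" "bracket x (b - y)"]
      by (simp add: coset_eq_iff diff_left diff_right)
  qed
  moreover have "x \<in> coset x" "y \<in> coset y"
    by (simp_all add: mem_coset_iff)
  ultimately show ?thesis
    unfolding quot_bracket_def by blast
qed

subsection \<open>Heisenberg-Fock Leibniz algebras\<close>

definition heis_iso :: "nat \<Rightarrow> ('l set \<Rightarrow> (heis_gen \<Rightarrow>\<^sub>0 'f)) \<Rightarrow> bool" where
  "heis_iso k \<phi> \<longleftrightarrow>
     bij_betw \<phi> lie_quot (heis k) \<and>
     (\<forall>A\<in>lie_quot. \<forall>B\<in>lie_quot. \<phi> (quot_add A B) = \<phi> A + \<phi> B) \<and>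
     (\<forall>c. \<forall>A\<in>lie_quot. \<phi> (quot_scale c A) = fs_scale c (\<phi> A)) \<and>
     (\<forall>A\<in>lie_quot. \<forall>B\<in>lie_quot. \<phi> (quot_bracket A B) = heis_bracket (\<phi> A) (\<phi> B))"

text \<open>
  Under \<open>\<phi>\<close>, the action \<open>(i, coset x) \<mapsto> bracket i x\<close> of the quotient on \<open>I\<close> becomes an
  action of the Heisenberg algebra; \<open>\<psi>\<close> identifies it with the Fock module.
\<close>

definition fock_iso ::
  "nat \<Rightarrow> ('l set \<Rightarrow> (heis_gen \<Rightarrow>\<^sub>0 'f)) \<Rightarrow> ('l \<Rightarrow> ((nat \<Rightarrow>\<^sub>0 nat) \<Rightarrow>\<^sub>0 'f)) \<Rightarrow> bool" where
  "fock_iso k \<phi> \<psi> \<longleftrightarrow>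
     bij_betw \<psi> leib_ker (fock k) \<and>
     (\<forall>i\<in>leib_ker. \<forall>j\<in>leib_ker. \<psi> (i + j) = \<psi> i + \<psi> j) \<and>
     (\<forall>c. \<forall>i\<in>leib_ker. \<psi> (scale c i) = fs_scale c (\<psi> i)) \<and>
     (\<forall>i\<in>leib_ker. \<forall>x. \<psi> (bracket i x) = fock_action (\<psi> i) (\<phi> (coset x)))"

end

locale heisenberg_fock_leibniz = leibniz_algebra scale bracket
  for scale :: "'f::field \<Rightarrow> 'l::ab_group_add \<Rightarrow> 'l" and bracket :: "'l \<Rightarrow> 'l \<Rightarrow> 'l" +
  fixes k :: nat
  assumes heisenberg_fock: "\<exists>\<phi> \<psi>. heis_iso k \<phi> \<and> fock_iso k \<phi> \<psi>"


section \<open>The multiplication table\<close>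

text \<open>\<open>Gen a\<close> labels the basis element lifting \<open>a\<close>, and \<open>Mon t\<close> the monomial with exponents \<open>t\<close>.\<close>

datatype hf_label = Gen heis_gen | Mon "nat \<Rightarrow>\<^sub>0 nat"

definition hf_labels :: "nat \<Rightarrow> hf_label set" where
  "hf_labels k = Gen ` heis_gens k \<union> Mon ` exps k"

text \<open>
  \<open>hf_table scale e a b\<close> is the prescribed product of \<open>e a\<close> and \<open>e b\<close>.  In the clause for
  \<open>Hd i\<close> on monomials the scalar is zero when the exponent subtraction is truncated.
\<close>

fun hf_table ::
  "('f::field \<Rightarrow> 'l::ab_group_add \<Rightarrow> 'l) \<Rightarrow> (hf_label \<Rightarrow> 'l) \<Rightarrow> hf_label \<Rightarrow> hf_label \<Rightarrow> 'l" where
  "hf_table scale e (Gen (Hx i)) (Gen (Hd j)) = (if i = j then e (Gen H1) else 0)"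
| "hf_table scale e (Gen (Hd i)) (Gen (Hx j)) = (if i = j then - e (Gen H1) else 0)"
| "hf_table scale e (Mon t) (Gen H1) = e (Mon t)"
| "hf_table scale e (Mon t) (Gen (Hx i)) = e (Mon (t + Poly_Mapping.single i 1))"
| "hf_table scale e (Mon t) (Gen (Hd i)) =
     scale (of_nat (Poly_Mapping.lookup t i)) (e (Mon (t - Poly_Mapping.single i 1)))"
| "hf_table scale e _ _ = 0"

end

theory Submission
  imports Defs
begin

text \<open>
  Let \<open>u\<close> lift the central element \<open>1\<close> of the Heisenberg algebra, and let \<open>R\<close> be right
  multiplication by \<open>u\<close>.  Since \<open>1\<close> is central and acts as the identity on the Fock module,
  \<open>R\<close> maps \<open>L\<close> into \<open>I\<close> and restricts to the identity on \<open>I\<close>, so that \<open>L\<close> is the direct sum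
  of \<open>ker R\<close> and \<open>I\<close>.  The Leibniz identity together with \<open>[L, I] = 0\<close> shows that \<open>ker R\<close> is
  closed under products.  Hence \<open>ker R\<close> is a subalgebra that the quotient map identifies with
  the Heisenberg algebra, and lifting its standard basis to \<open>ker R\<close> gives the table.
\<close>

section \<open>Finitely supported functions\<close>

lemma lookup_fs_scale: "Poly_Mapping.lookup (fs_scale c p) a = c * Poly_Mapping.lookup p a"
  by (simp add: fs_scale_def Poly_Mapping.map.rep_eq when_def)

lemma fs_scale_one: "fs_scale (1::'f::semiring_1) p = p"
  by (rule poly_mapping_eqI) (simp add: lookup_fs_scale)

lemma fs_scale_zero: "fs_scale c 0 = 0"
  by (rule poly_mapping_eqI) (simp add: lookup_fs_scale)

lemma fs_scale_single: "fs_scale c (Poly_Mapping.single a d) = Poly_Mapping.single a (c * d)"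
  by (rule poly_mapping_eqI) (simp add: lookup_fs_scale lookup_single when_def)

lemma sum_keys_single:
  "p = (\<Sum>a\<in>Poly_Mapping.keys p. Poly_Mapping.single a (Poly_Mapping.lookup p a))"
  by (rule poly_mapping_eqI) (auto simp: lookup_sum lookup_single when_def in_keys_iff)

text \<open>\<open>p\<close> is a finite sum of scaled \<open>Poly_Mapping.single a 1\<close> with
  \<open>a\<close> in its support. With \<open>T\<close> the image of a subspace under a linear map,
  this yields preimages in that subspace.\<close>

lemma fs_generated:
  fixes p :: "'b \<Rightarrow>\<^sub>0 'f::semiring_1"
  assumes "0 \<in> T"
    and add: "\<And>p q. p \<in> T \<Longrightarrow> q \<in> T \<Longrightarrow> p + q \<in> T"
    and scale: "\<And>c p. p \<in> T \<Longrightarrow> fs_scale c p \<in> T"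
    and single: "\<And>a. a \<in> A \<Longrightarrow> Poly_Mapping.single a 1 \<in> T"
    and keys: "Poly_Mapping.keys p \<subseteq> A"
  shows "p \<in> T"
proof -
  have sums: "(\<Sum>a\<in>F. Poly_Mapping.single a (Poly_Mapping.lookup p a)) \<in> T"
    if "finite F" "F \<subseteq> A" for F
    using that
  proof (induction F)
    case (insert a F)
    then have "fs_scale (Poly_Mapping.lookup p a) (Poly_Mapping.single a 1) \<in> T"
      by (intro scale single) simp
    with insert show ?case
      by (simp add: add fs_scale_single)
  qed (simp add: assms(1))
  show ?thesis
    using sums[OF finite_keys keys] by (simp only: sum_keys_single[symmetric])
qed

lemma heis_bracket_single:
  "heis_bracket (Poly_Mapping.single a 1) (Poly_Mapping.single b 1) = heis_gen_bracket a b"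
  by (simp add: heis_bracket_def fs_scale_one)

lemma fock_action_single: "fock_action p (Poly_Mapping.single a 1) = fock_gen_action p a"
  by (simp add: fock_action_def fs_scale_one)

text \<open>Centrality of \<open>H1\<close>: right multiplication by a lift of it takes values in
  the ideal of squares.\<close>

lemma heis_bracket_single_H1:
  "heis_bracket h (Poly_Mapping.single H1 1) = 0"
proof -
  have "heis_gen_bracket a H1 = 0" for a
    by (cases a) simp_all
  then show ?thesis
    by (simp add: heis_bracket_def fs_scale_zero)
qed

lemma partial_deriv_single:
  "partial_deriv i (Poly_Mapping.single t 1) =
     Poly_Mapping.single (t - Poly_Mapping.single i 1) (of_nat (Poly_Mapping.lookup t i))"
  by (simp add: partial_deriv_def)

lemma poly_var_times_single:
  "poly_var i * Poly_Mapping.single t (1::'f::comm_ring_1) = Poly_Mapping.single (t + Poly_Mapping.single i 1) 1"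
  by (simp add: poly_var_def mult_single add.commute)

lemma single_in_heis: "a \<in> heis_gens k \<Longrightarrow> Poly_Mapping.single a (1::'f::zero_neq_one) \<in> heis k"
  by (simp add: heis_def)

lemma single_in_fock: "t \<in> exps k \<Longrightarrow> Poly_Mapping.single t (1::'f::zero_neq_one) \<in> fock k"
  by (simp add: fock_def)

lemma exps_plus_single: "t \<in> exps k \<Longrightarrow> i \<in> {1..k} \<Longrightarrow> t + Poly_Mapping.single i 1 \<in> exps k"
  using keys_add[of t "Poly_Mapping.single i 1"] by (auto simp: exps_def split: if_splits)

text \<open>Truncated subtraction never enlarges the support, so the \<open>Hd\<close> clause of the
  table stays among the labels even when the exponent is 0.\<close>

lemma exps_minus: "t \<in> exps k \<Longrightarrow> t - s \<in> exps k"
  by (auto simp: exps_def in_keys_iff lookup_minus subset_iff)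

section \<open>Linear algebra\<close>

text \<open>The zero set of \<open>f a\<close> is a subspace containing every \<open>e b\<close>
  with \<open>b\<close> other than \<open>a\<close>, hence their span, but it misses
  \<open>e a\<close>.\<close>

lemma (in vector_space) independent_if_dual_functionals:
  assumes f: "\<And>a. a \<in> A \<Longrightarrow> subspace {x. f a x = 0}"
    and diag: "\<And>a. a \<in> A \<Longrightarrow> f a (e a) \<noteq> (0::'c::zero)"
    and off: "\<And>a b. a \<in> A \<Longrightarrow> b \<in> A \<Longrightarrow> a \<noteq> b \<Longrightarrow> f a (e b) = 0"
  shows "inj_on e A" and "independent (e ` A)"
proof -
  show "inj_on e A"
    by (rule inj_onI) (metis diag off)
  show "independent (e ` A)"
    unfolding dependent_def
  proof clarify
    fix a
    assume a: "a \<in> A" "e a \<in> span (e ` A - {e a})"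
    have "span (e ` A - {e a}) \<subseteq> {x. f a x = 0}"
      using a off by (intro span_minimal f) auto
    with a diag show False
      by auto
  qed
qed

section \<open>Splitting off the ideal of squares\<close>

context leibniz_algebra
begin

lemma hom_left: "module_hom scale scale (\<lambda>x. bracket x y)"
  using linear_left by (simp add: Vector_Spaces.linear_def)

lemma hom_right: "module_hom scale scale (bracket x)"
  using linear_right by (simp add: Vector_Spaces.linear_def)

lemmas bracket_add_left = module_hom.add[OF hom_left]
  and bracket_diff_left = module_hom.diff[OF hom_left]
  and bracket_scale_left = module_hom.scale[OF hom_left]
  and bracket_zero_left = module_hom.zero[OF hom_left]
  and bracket_neg_left = module_hom.neg[OF hom_left]
  and bracket_add_right = module_hom.add[OF hom_right]
  and bracket_scale_right = module_hom.scale[OF hom_right]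
  and bracket_zero_right = module_hom.zero[OF hom_right]

lemma subspace_leib_ker: "subspace leib_ker"
  using is_ideal_leib_ker by (simp add: is_ideal_def)

lemma bracket_leib_ker: "j \<in> leib_ker \<Longrightarrow> bracket j x \<in> leib_ker"
  using is_ideal_leib_ker by (simp add: is_ideal_def)

text \<open>The elements annihilated by all left multiplications form an ideal. It contains each
  square, since the Leibniz identity for \<open>[[x, y], y]\<close> cancels down to
  \<open>[x, [y, y]] = 0\<close>; so it contains the ideal generated by the squares.\<close>

lemma bracket_right_leib_ker:
  assumes "j \<in> leib_ker"
  shows "bracket x j = 0"
proof -
  let ?A = "{j. \<forall>x. bracket x j = 0}"
  have "subspace ?A"
    by (auto simp: subspace_def bracket_zero_right bracket_add_right bracket_scale_right)
  moreover have "bracket x (bracket j y) = 0" if "j \<in> ?A" for x j y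
    using leibniz[of x j y] that by (simp add: bracket_zero_left)
  ultimately have "is_ideal ?A"
    by (auto simp: is_ideal_def bracket_zero_right)
  moreover have "bracket x (bracket y y) = 0" for x y
    using leibniz[of x y y] by simp
  ultimately have "leib_ker \<subseteq> ?A"
    unfolding leib_ker_def by (intro hull_minimal) auto
  with assms show ?thesis
    by blast
qed

theorem heisenberg_fock_basis:
  assumes \<phi>: "heis_iso k \<phi>" and \<psi>: "fock_iso k \<phi> \<psi>"
  shows "\<exists>e :: hf_label \<Rightarrow> 'l.
    inj_on e (hf_labels k) \<and> independent (e ` hf_labels k) \<and> span (e ` hf_labels k) = UNIV \<and>
    (\<forall>a\<in>hf_labels k. \<forall>b\<in>hf_labels k. bracket (e a) (e b) = hf_table scale e a b)"
proof -

  \<comment> \<open>The projection onto the Heisenberg algebra\<close>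
  define q where "q x = \<phi> (coset x)" for x
  have in_quot: "coset x \<in> lie_quot" for x
    by (simp add: lie_quot_def)
  have q_add: "q (x + y) = q x + q y" for x y
    using \<phi> in_quot unfolding heis_iso_def q_def by (metis quot_add_coset)
  have q_scale: "q (scale c x) = fs_scale c (q x)" for c x
    using \<phi> in_quot unfolding heis_iso_def q_def by (metis quot_scale_coset)
  have q_bracket: "q (bracket x y) = heis_bracket (q x) (q y)" for x y
    using \<phi> in_quot unfolding heis_iso_def q_def by (metis quot_bracket_coset)
  have q_zero: "q 0 = 0"
    using q_add[of 0 0] by simp
  have q_neg: "q (- x) = - q x" for x
    using q_add[of "- x" x] q_zero by (simp add: eq_neg_iff_add_eq_0)
  have q_diff: "q (x - y) = q x - q y" for x y
    using q_add[of x "- y"] q_neg by simp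
  have \<phi>_bij: "bij_betw \<phi> lie_quot (heis k)"
    using \<phi> by (simp add: heis_iso_def)
  have q_eq_iff: "q x = q y \<longleftrightarrow> x - y \<in> leib_ker" for x y
    using inj_on_eq_iff[OF bij_betw_imp_inj_on[OF \<phi>_bij] in_quot in_quot]
    by (simp add: q_def coset_eq_iff)
  have q_leib_ker: "q j = 0" if "j \<in> leib_ker" for j
    using q_eq_iff[of j 0] q_zero that by simp
  have q_heis: "q x \<in> heis k" for x
    using bij_betwE[OF \<phi>_bij] in_quot by (simp add: q_def)
  have q_surj: "\<exists>x. q x = h" if "h \<in> heis k" for h
    using bij_betw_imp_surj_on[OF \<phi>_bij] that by (force simp: q_def lie_quot_def)

  \<comment> \<open>The identification of the ideal with the Fock module\<close>
  have \<psi>_bij: "bij_betw \<psi> leib_ker (fock k)"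
    and \<psi>_add: "\<And>i j. i \<in> leib_ker \<Longrightarrow> j \<in> leib_ker \<Longrightarrow> \<psi> (i + j) = \<psi> i + \<psi> j"
    and \<psi>_scale: "\<And>c i. i \<in> leib_ker \<Longrightarrow> \<psi> (scale c i) = fs_scale c (\<psi> i)"
    and \<psi>_bracket: "\<And>i x. i \<in> leib_ker \<Longrightarrow> \<psi> (bracket i x) = fock_action (\<psi> i) (q x)"
    using \<psi> by (auto simp: fock_iso_def q_def)
  note \<psi>_inj = inj_onD[OF bij_betw_imp_inj_on[OF \<psi>_bij]]
  have zero_ker: "0 \<in> leib_ker"
    by (rule subspace_0[OF subspace_leib_ker])
  have \<psi>_zero: "\<psi> 0 = 0"
    using \<psi>_add[OF zero_ker zero_ker] by (simp only: add_0_left add_cancel_right_right)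

  \<comment> \<open>The complement of the ideal\<close>
  have H1: "H1 \<in> heis_gens k"
    by (simp add: heis_gens_def)
  obtain u where u: "q u = Poly_Mapping.single H1 1"
    using q_surj[OF single_in_heis[OF H1]] by blast
  have R_id: "bracket j u = j" if "j \<in> leib_ker" for j
    using that by (intro \<psi>_inj bracket_leib_ker) (simp_all add: \<psi>_bracket u fock_action_single)
  have R_ker: "bracket x u \<in> leib_ker" for x
    using q_eq_iff[of "bracket x u" 0] by (simp add: q_bracket u q_zero heis_bracket_single_H1)
  define K where "K = {x. bracket x u = 0}"
  \<comment> \<open>\<open>x - y\<close> lies in both \<open>K\<close> and \<open>leib_ker\<close>,
    so right multiplication by \<open>u\<close> both kills and fixes it.\<close>
  have K_eq: "x = y" if "x \<in> K" "y \<in> K" "q x = q y" for x y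
    using R_id[of "x - y"] that by (simp add: q_eq_iff K_def bracket_diff_left)
  \<comment> \<open>In \<open>[[x, y], u] = [[x, u], y] + [x, [y, u]]\<close> the first summand
    vanishes because \<open>x\<close> is in \<open>K\<close>, the second because
    \<open>[y, u]\<close> is in \<open>leib_ker\<close>.\<close>
  have K_bracket: "bracket x y \<in> K" if "x \<in> K" for x y
    using leibniz[of x y u] that
    by (simp add: K_def bracket_zero_left bracket_right_leib_ker R_ker)
  have "\<exists>x\<in>K. q x = Poly_Mapping.single a 1" if a: "a \<in> heis_gens k" for a
  proof -
    obtain x where x: "q x = Poly_Mapping.single a 1"
      using q_surj[OF single_in_heis[OF a]] by blast
    \<comment> \<open>Right multiplication by \<open>u\<close> is idempotent with image
      \<open>leib_ker\<close>; subtracting it projects \<open>x\<close> to \<open>K\<close> without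
      changing its coset.\<close>
    have "x - bracket x u \<in> K" "q (x - bracket x u) = Poly_Mapping.single a 1"
      by (simp_all add: K_def bracket_diff_left R_id R_ker q_diff q_leib_ker x)
    then show ?thesis
      by blast
  qed
  then obtain g where g_K: "\<And>a. a \<in> heis_gens k \<Longrightarrow> g a \<in> K"
    and q_g: "\<And>a. a \<in> heis_gens k \<Longrightarrow> q (g a) = Poly_Mapping.single a 1"
    by metis
  have "\<exists>i\<in>leib_ker. \<psi> i = Poly_Mapping.single t 1" if "t \<in> exps k" for t
    using bij_betw_imp_surj_on[OF \<psi>_bij] single_in_fock[OF that] by (metis imageE)
  then obtain m where m_ker: "\<And>t. t \<in> exps k \<Longrightarrow> m t \<in> leib_ker"
    and \<psi>_m: "\<And>t. t \<in> exps k \<Longrightarrow> \<psi> (m t) = Poly_Mapping.single t 1"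
    by metis
  define e where "e = case_hf_label g m"
  have e_simps: "e (Gen a) = g a" "e (Mon t) = m t" for a t
    by (simp_all add: e_def)

  \<comment> \<open>Coordinate functionals for linear independence. A \<open>Mon\<close> coordinate
    is read off from the component \<open>bracket x u\<close> of \<open>x\<close> in
    \<open>leib_ker\<close>, because \<open>\<psi>\<close> is linear only there; this component is 0
    for \<open>g a\<close>.\<close>
  define f where "f l x = (case l of Gen a \<Rightarrow> Poly_Mapping.lookup (q x) a
      | Mon t \<Rightarrow> Poly_Mapping.lookup (\<psi> (bracket x u)) t)" for l x
  have sub: "subspace {x. f l x = 0}" for l
    by (cases l)
      (auto simp: subspace_def f_def q_zero q_add q_scale bracket_zero_left bracket_add_left
        bracket_scale_left \<psi>_zero \<psi>_add \<psi>_scale R_ker lookup_add lookup_fs_scale)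
  have dual: "f l (e l') = (if l = l' then 1 else 0)" if "l \<in> hf_labels k" "l' \<in> hf_labels k" for l l'
    using that g_K
    by (cases l; cases l')
      (auto simp: hf_labels_def f_def e_simps q_g q_leib_ker m_ker R_id \<psi>_m K_def \<psi>_zero
        lookup_single when_def)
  have basis: "inj_on e (hf_labels k)" "independent (e ` hf_labels k)"
    by (rule independent_if_dual_functionals[of "hf_labels k" f e]; use sub dual in simp)+

  \<comment> \<open>Spanning\<close>
  let ?S = "span (e ` hf_labels k)"
  have g_S: "g a \<in> ?S" if "a \<in> heis_gens k" for a
    using that by (intro span_base image_eqI[of _ _ "Gen a"]) (simp_all add: e_simps hf_labels_def)
  have m_S: "m t \<in> ?S" if "t \<in> exps k" for t
    using that by (intro span_base image_eqI[of _ _ "Mon t"]) (simp_all add: e_simps hf_labels_def)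
  have ker_S: "j \<in> ?S" if j: "j \<in> leib_ker" for j
  proof -
    have "Poly_Mapping.keys (\<psi> j) \<subseteq> exps k"
      using bij_betwE[OF \<psi>_bij] j by (simp add: fock_def)
    then have "\<psi> j \<in> \<psi> ` (leib_ker \<inter> ?S)"
    proof (rule fs_generated[rotated 4])
      show "0 \<in> \<psi> ` (leib_ker \<inter> ?S)"
        using zero_ker span_zero \<psi>_zero by (metis IntI image_eqI)
    next
      fix p p'
      assume "p \<in> \<psi> ` (leib_ker \<inter> ?S)" "p' \<in> \<psi> ` (leib_ker \<inter> ?S)"
      then obtain i i' where "p = \<psi> i" "p' = \<psi> i'" "i \<in> leib_ker" "i \<in> ?S" "i' \<in> leib_ker" "i' \<in> ?S"
        by blast
      then show "p + p' \<in> \<psi> ` (leib_ker \<inter> ?S)"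
        by (intro image_eqI[of _ _ "i + i'"])
          (simp_all add: \<psi>_add span_add subspace_add[OF subspace_leib_ker])
    next
      fix c p
      assume "p \<in> \<psi> ` (leib_ker \<inter> ?S)"
      then obtain i where "p = \<psi> i" "i \<in> leib_ker" "i \<in> ?S"
        by blast
      then show "fs_scale c p \<in> \<psi> ` (leib_ker \<inter> ?S)"
        by (intro image_eqI[of _ _ "scale c i"])
          (simp_all add: \<psi>_scale span_scale subspace_scale[OF subspace_leib_ker])
    next
      fix t
      assume "t \<in> exps k"
      then show "Poly_Mapping.single t 1 \<in> \<psi> ` (leib_ker \<inter> ?S)"
        by (intro image_eqI[of _ _ "m t"]) (simp_all add: \<psi>_m m_ker m_S)
    qed
    then show ?thesis
      using \<psi>_inj[OF _ j] by blast
  qed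
  have "x \<in> ?S" for x
  proof -
    have "Poly_Mapping.keys (q x) \<subseteq> heis_gens k"
      using q_heis by (simp add: heis_def)
    \<comment> \<open>First \<open>x\<close> is matched modulo \<open>leib_ker\<close> by some
      \<open>y\<close> in the span; the remainder \<open>x - y\<close> is covered by
      \<open>ker_S\<close>.\<close>
    then have "q x \<in> q ` ?S"
    proof (rule fs_generated[rotated 4])
      show "0 \<in> q ` ?S"
        using span_zero q_zero by (metis image_eqI)
      show "p + p' \<in> q ` ?S" if "p \<in> q ` ?S" "p' \<in> q ` ?S" for p p'
        using that span_add by (auto simp flip: q_add)
      show "fs_scale c p \<in> q ` ?S" if "p \<in> q ` ?S" for c p
        using that span_scale by (auto simp flip: q_scale)
      show "Poly_Mapping.single a 1 \<in> q ` ?S" if "a \<in> heis_gens k" for a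
        using q_g[OF that] g_S[OF that] by (metis image_eqI)
    qed
    then obtain y where "y \<in> ?S" "x - y \<in> leib_ker"
      using q_eq_iff by blast
    then show ?thesis
      using span_add[of y _ "x - y"] ker_S by simp
  qed
  then have span: "?S = UNIV"
    by blast

  \<comment> \<open>The multiplication table\<close>
  have K_zero: "0 \<in> K" and K_neg: "x \<in> K \<Longrightarrow> - x \<in> K" for x
    by (simp_all add: K_def bracket_zero_left bracket_neg_left)
  have table_GG: "bracket (g a) (g b) = hf_table scale e (Gen a) (Gen b)"
    if ab: "a \<in> heis_gens k" "b \<in> heis_gens k" for a b
  \<comment> \<open>Both sides lie in \<open>K\<close>, where \<open>q\<close> is injective, so it
    suffices to compare them in the Heisenberg algebra.\<close>
  proof (rule K_eq)
    show "bracket (g a) (g b) \<in> K"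
      using ab by (intro K_bracket g_K)
    show "hf_table scale e (Gen a) (Gen b) \<in> K"
      by (cases a; cases b) (simp_all add: e_simps K_zero K_neg g_K H1)
    show "q (bracket (g a) (g b)) = q (hf_table scale e (Gen a) (Gen b))"
      using ab unfolding q_bracket q_g[OF ab(1)] q_g[OF ab(2)] heis_bracket_single
      by (cases a; cases b) (simp_all add: e_simps q_zero q_neg q_g H1)
  qed
  have table_MG: "bracket (m t) (g a) = hf_table scale e (Mon t) (Gen a)"
    if t: "t \<in> exps k" and a: "a \<in> heis_gens k" for t a
  \<comment> \<open>Both sides lie in \<open>leib_ker\<close>, so the comparison takes place in the
    Fock module.\<close>
  proof (rule \<psi>_inj)
    have gen: "i \<in> {1..k}" if "a = Hx i \<or> a = Hd i" for i
      using a that by (auto simp: heis_gens_def)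
    show "bracket (m t) (g a) \<in> leib_ker"
      using t by (intro bracket_leib_ker m_ker)
    show "hf_table scale e (Mon t) (Gen a) \<in> leib_ker"
      using t gen exps_plus_single[of t k] exps_minus[of t k]
      by (cases a) (auto simp: e_simps m_ker subspace_scale[OF subspace_leib_ker])
    show "\<psi> (bracket (m t) (g a)) = \<psi> (hf_table scale e (Mon t) (Gen a))"
      using gen t exps_plus_single[OF t]
      unfolding \<psi>_bracket[OF m_ker[OF t]] q_g[OF a] \<psi>_m[OF t] fock_action_single
      by (cases a)
        (simp_all add: e_simps \<psi>_m \<psi>_scale m_ker exps_minus partial_deriv_single
          poly_var_times_single fs_scale_single del: One_nat_def)
  qed
  have "bracket (e a) (e b) = hf_table scale e a b"
    if "a \<in> hf_labels k" "b \<in> hf_labels k" for a b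
    using that table_GG table_MG
    \<comment> \<open>Products whose right factor is a monomial vanish because
      \<open>[L, I] = 0\<close>.\<close>
    by (cases a; cases b) (auto simp: hf_labels_def e_simps bracket_right_leib_ker m_ker)
  with basis span show ?thesis
    by blast
qed

end

theorem theorem1:
  fixes scale :: "'f::{alg_closed_field, field_char_0} \<Rightarrow> 'l::ab_group_add \<Rightarrow> 'l"
    and bracket :: "'l \<Rightarrow> 'l \<Rightarrow> 'l"
    and k :: nat
  assumes "heisenberg_fock_leibniz scale bracket k"
  shows "\<exists>e :: hf_label \<Rightarrow> 'l.
    inj_on e (hf_labels k) \<and>
    \<not> module.dependent scale (e ` hf_labels k) \<and>
    module.span scale (e ` hf_labels k) = UNIV \<and>
    (\<forall>a\<in>hf_labels k. \<forall>b\<in>hf_labels k. bracket (e a) (e b) = hf_table scale e a b)"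
proof -
  interpret heisenberg_fock_leibniz scale bracket k
    by (rule assms)
  show ?thesis
    using heisenberg_fock heisenberg_fock_basis by blast
qed

end
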